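(* Let $D$ be a principal ideal domain and let $\alpha = \begin{pmatrix} a & b \\ 0 & a \end{pmatrix} \in R(D)$ with $a,b\in D$. Then $\alpha$ is irreducible in $R(D)$ if and only if one of the following holds: (i) $a = 0$ and $b \in U(D)$; (ii) $a = p$ for some prime element $p \in D$; (iii) $a = up^n$ and $1 \in \mathrm{GCD}(a,b)$ for some prime element $p \in D$, some $u \in U(D)$, and some integer $n \geq 2$.
   Context: For an integral domain $D$, $R(D) = \left\{\begin{pmatrix} a & b \\ 0 & a \end{pmatrix} : a,b \in D\right\}$, a commutative ring with identity under matrix addition and multiplication (the self-idealization of $D$). For a commutative ring $R$ with identity, $U(R)$ is its group of units. Elements $a,b\in R$ are associates if $aR=bR$. A nonunit $a \in R$ is irreducible if $a=bc$ with $b,c\in R$ implies that $b$ or $c$ is associated with $a$. $\mathrm{GCD}(a,b)$ denotes the set of greatest common divisors of $a,b$ in $D$, so $1\in \mathrm{GCD}(a,b)$ means that $a$ and $b$ are coprime. Prime elements are nonzero nonunits. *)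

theory Defs
  imports "HOL-Algebra.Algebra" "HOL-Analysis.Finite_Cartesian_Product"
begin

text \<open>
  The integral domain \<open>D\<close> is a carrier-based ring, so its entries
  need no type-class arithmetic and the matrix operations on the type of square matrices have to
  be built from the operations of \<open>D\<close>.
\<close>

definition matrix_ring :: "('a, 'm) ring_scheme \<Rightarrow> ('a ^ 'n ^ 'n) ring" where
  "matrix_ring D =
    \<lparr> carrier = {A. \<forall>i j. A $ i $ j \<in> carrier D},
      monoid.mult = (\<lambda>A B. \<chi> i j. \<Oplus>\<^bsub>D\<^esub>k\<in>UNIV. A $ i $ k \<otimes>\<^bsub>D\<^esub> B $ k $ j),
      one = (\<chi> i j. if i = j then \<one>\<^bsub>D\<^esub> else \<zero>\<^bsub>D\<^esub>),
      ring.zero = (\<chi> i j. \<zero>\<^bsub>D\<^esub>),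
      add = (\<lambda>A B. \<chi> i j. A $ i $ j \<oplus>\<^bsub>D\<^esub> B $ i $ j) \<rparr>"

text \<open>The matrix with rows \<open>(a, b)\<close> and \<open>(0, a)\<close>; the two elements of the index type
  \<^typ>\<open>2\<close> are written \<open>1\<close> and \<open>2\<close>, the latter being the same element as \<open>0\<close>.\<close>

definition self_ideal_mat :: "('a, 'm) ring_scheme \<Rightarrow> 'a \<Rightarrow> 'a \<Rightarrow> 'a ^ 2 ^ 2" where
  "self_ideal_mat D a b =
    (\<chi> i j. if i = j then a else if i = 1 \<and> j = 2 then b else \<zero>\<^bsub>D\<^esub>)"

definition self_idealization :: "('a, 'm) ring_scheme \<Rightarrow> ('a ^ 2 ^ 2) ring" where
  "self_idealization D =
    (matrix_ring D)\<lparr> carrier := {self_ideal_mat D a b | a b. a \<in> carrier D \<and> b \<in> carrier D} \<rparr>"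

text \<open>
  The following two notions are meant for a commutative ring \<open>R\<close>. With zero divisors,
  generating the same principal ideal is weaker than differing by a unit factor, and the
  irreducibility below differs from the library's \<^const>\<open>Divisibility.irreducible\<close>, which asks that
  every proper divisor be a unit.
\<close>

definition same_ideal_associates :: "('a, 'm) ring_scheme \<Rightarrow> 'a \<Rightarrow> 'a \<Rightarrow> bool" where
  "same_ideal_associates R a b \<longleftrightarrow> PIdl\<^bsub>R\<^esub> a = PIdl\<^bsub>R\<^esub> b"

definition associate_irreducible :: "('a, 'm) ring_scheme \<Rightarrow> 'a \<Rightarrow> bool" where
  "associate_irreducible R a \<longleftrightarrow>
    a \<in> carrier R \<and> a \<notin> Units R \<and>
    (\<forall>b \<in> carrier R. \<forall>c \<in> carrier R. a = b \<otimes>\<^bsub>R\<^esub> c \<longrightarrow>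
      same_ideal_associates R b a \<or> same_ideal_associates R c a)"

end

theory Submission
  imports Defs "HOL-Analysis.Cartesian_Space"
begin

text \<open>
  Write \<open>(a, b)\<close> for the matrix with rows \<open>(a, b)\<close> and \<open>(0, a)\<close>. Multiplication is
  \<open>(c, d) (e, f) = (c e, c f + d e)\<close>, as for dual numbers \<open>c + d \<epsilon>\<close> with \<open>\<epsilon>\<^sup>2 = 0\<close>, and an element is
  a unit exactly when its first entry is one.

  For \<open>a \<noteq> 0\<close> the element \<open>(a, b)\<close> is not a zero divisor, so that a factor of it is associated
  with it only if the cofactor is a unit. So \<open>(a, b)\<close> is irreducible iff \<open>a\<close> is a nonunit and there is no factorization
  \<open>a = c e\<close> into nonunits of \<open>D\<close> for which \<open>b\<close> lies in the ideal \<open>(c, e)\<close>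
  (\<open>associate_irreducible_nonzero\<close>). Over a principal ideal domain this settles everything:

  \<^item> Let \<open>p\<close> be a prime divisor of \<open>a\<close> and \<open>a = p\<^sup>n q\<close> with \<open>p\<close> not dividing \<open>q\<close>. If \<open>q\<close> is a
    nonunit, then \<open>p\<^sup>n\<close> and \<open>q\<close> generate the unit ideal, which contains \<open>b\<close>; so \<open>q\<close> has to be a unit.
  \<^item> If \<open>a = u p\<^sup>n\<close> with \<open>n \<ge> 2\<close> and \<open>p\<close> divides \<open>b\<close>, then \<open>a = p (u p\<^bsup>n-1\<^esup>)\<close> is a factorization
    with \<open>b\<close> in the ideal \<open>(p)\<close>. So \<open>p\<close> does not divide \<open>b\<close>, which is coprimality of \<open>a\<close> and \<open>b\<close>.
  \<^item> Conversely, for \<open>a = u p\<^sup>n\<close> both nonunit factors \<open>c\<close>, \<open>e\<close> are divisible by \<open>p\<close>, so that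
    every element of \<open>(c, e)\<close> is too.

  For \<open>a = 0\<close> the factorization \<open>(0, b) = (b, 0) (0, 1)\<close> shows that \<open>b\<close> must be a unit
  (\<open>associate_irreducible_zero\<close>).
\<close>

section \<open>The ring of matrices with a repeated diagonal entry\<close>

lemma self_ideal_mat_eq_iff:
  "self_ideal_mat R a b = self_ideal_mat R c d \<longleftrightarrow> a = c \<and> b = d"
proof -
  have "self_ideal_mat R x y $ 1 $ 1 = x" "self_ideal_mat R x y $ 1 $ 2 = y" for x y
    by (simp_all add: self_ideal_mat_def)
  then show ?thesis
    by metis
qed

lemma carrier_self_idealization:
  "carrier (self_idealization R) = {self_ideal_mat R a b | a b. a \<in> carrier R \<and> b \<in> carrier R}"
  by (simp add: self_idealization_def)

lemma self_ideal_mat_in_carrier_iff: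
  "self_ideal_mat R a b \<in> carrier (self_idealization R) \<longleftrightarrow> a \<in> carrier R \<and> b \<in> carrier R"
  by (auto simp: carrier_self_idealization self_ideal_mat_eq_iff)

lemma one_self_idealization: "\<one>\<^bsub>self_idealization R\<^esub> = self_ideal_mat R \<one>\<^bsub>R\<^esub> \<zero>\<^bsub>R\<^esub>"
  by (simp add: self_idealization_def matrix_ring_def self_ideal_mat_def vec_eq_iff)

lemma zero_self_idealization: "\<zero>\<^bsub>self_idealization R\<^esub> = self_ideal_mat R \<zero>\<^bsub>R\<^esub> \<zero>\<^bsub>R\<^esub>"
  by (simp add: self_idealization_def matrix_ring_def self_ideal_mat_def vec_eq_iff)

context cring
begin

lemma add_self_ideal_mat:
  assumes "a \<in> carrier R" "b \<in> carrier R" "c \<in> carrier R" "d \<in> carrier R"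
  shows "self_ideal_mat R a b \<oplus>\<^bsub>self_idealization R\<^esub> self_ideal_mat R c d
    = self_ideal_mat R (a \<oplus> c) (b \<oplus> d)"
  using assms by (simp add: self_idealization_def matrix_ring_def self_ideal_mat_def vec_eq_iff)

lemma mult_self_ideal_mat:
  assumes "a \<in> carrier R" "b \<in> carrier R" "c \<in> carrier R" "d \<in> carrier R"
  shows "self_ideal_mat R a b \<otimes>\<^bsub>self_idealization R\<^esub> self_ideal_mat R c d
    = self_ideal_mat R (a \<otimes> c) (a \<otimes> d \<oplus> b \<otimes> c)"
proof -
  have finsum_2: "finsum R f UNIV = f 1 \<oplus> f 2" if "f \<in> UNIV \<rightarrow> carrier R" for f :: "2 \<Rightarrow> 'a"
    using that by (simp add: UNIV_2 Pi_iff)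
  have "(\<Oplus>k\<in>UNIV. self_ideal_mat R a b $ i $ k \<otimes> self_ideal_mat R c d $ k $ j)
      = self_ideal_mat R (a \<otimes> c) (a \<otimes> d \<oplus> b \<otimes> c) $ i $ j" for i j
    using assms exhaust_2[of i] exhaust_2[of j]
    by (subst finsum_2) (auto simp: self_ideal_mat_def)
  then show ?thesis
    by (simp add: self_idealization_def matrix_ring_def vec_eq_iff)
qed

lemma cring_self_idealization: "cring (self_idealization R)"
proof -
  let ?S = "self_idealization R"
  note S_simps = carrier_self_idealization self_ideal_mat_eq_iff add_self_ideal_mat
    mult_self_ideal_mat one_self_idealization zero_self_idealization
  have "abelian_group ?S"
  proof (rule abelian_groupI)
    fix x assume "x \<in> carrier ?S"
    then obtain a b where x: "x = self_ideal_mat R a b" "a \<in> carrier R" "b \<in> carrier R"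
      by (auto simp: carrier_self_idealization)
    then have "self_ideal_mat R (\<ominus> a) (\<ominus> b) \<oplus>\<^bsub>?S\<^esub> x = \<zero>\<^bsub>?S\<^esub>"
      by (simp add: add_self_ideal_mat zero_self_idealization l_neg)
    with x show "\<exists>y\<in>carrier ?S. y \<oplus>\<^bsub>?S\<^esub> x = \<zero>\<^bsub>?S\<^esub>"
      by (metis self_ideal_mat_in_carrier_iff a_inv_closed)
  qed (auto simp: S_simps a_ac)
  moreover have "comm_monoid ?S"
    by (rule comm_monoidI) (auto simp: S_simps a_ac m_ac l_distr r_distr)
  moreover have "(x \<oplus>\<^bsub>?S\<^esub> y) \<otimes>\<^bsub>?S\<^esub> z = x \<otimes>\<^bsub>?S\<^esub> z \<oplus>\<^bsub>?S\<^esub> y \<otimes>\<^bsub>?S\<^esub> z"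
    if "x \<in> carrier ?S" "y \<in> carrier ?S" "z \<in> carrier ?S" for x y z
    using that by (auto simp: S_simps a_ac l_distr r_distr)
  ultimately show ?thesis
    by (rule cringI)
qed

lemma mult_eq_one_imp_Units:
  assumes "x \<in> carrier R" "y \<in> carrier R" "x \<otimes> y = \<one>"
  shows "x \<in> Units R"
  using assms divides_one dividesI by metis

lemma self_ideal_mat_Units_iff:
  assumes a: "a \<in> carrier R" and b: "b \<in> carrier R"
  shows "self_ideal_mat R a b \<in> Units (self_idealization R) \<longleftrightarrow> a \<in> Units R"
proof -
  interpret S: cring "self_idealization R"
    by (rule cring_self_idealization)
  show ?thesis
  proof
    assume "self_ideal_mat R a b \<in> Units (self_idealization R)"
    then obtain c d where "c \<in> carrier R" "d \<in> carrier R"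
      and "self_ideal_mat R a b \<otimes>\<^bsub>self_idealization R\<^esub> self_ideal_mat R c d
        = \<one>\<^bsub>self_idealization R\<^esub>"
      by (auto simp: Units_def carrier_self_idealization)
    then have "c \<in> carrier R" "a \<otimes> c = \<one>"
      using a b by (auto simp: mult_self_ideal_mat one_self_idealization self_ideal_mat_eq_iff)
    then show "a \<in> Units R"
      using a mult_eq_one_imp_Units by blast
  next
    assume u: "a \<in> Units R"
    (* with eps^2 = 0: 1/(a + b eps) = 1/a - (b/a^2) eps *)
    define c d where "c = inv a" and "d = \<ominus> (b \<otimes> c \<otimes> c)"
    have c: "c \<in> carrier R" "a \<otimes> c = \<one>" and d: "d \<in> carrier R"
      using u a b by (auto simp: c_def d_def)
    have "a \<otimes> d = \<ominus> (b \<otimes> c \<otimes> (a \<otimes> c))"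
      using a b c(1) by (simp add: d_def r_minus m_ac)
    then have "a \<otimes> d \<oplus> b \<otimes> c = \<zero>"
      using a b c by (simp add: l_neg)
    then have "self_ideal_mat R a b \<otimes>\<^bsub>self_idealization R\<^esub> self_ideal_mat R c d
        = \<one>\<^bsub>self_idealization R\<^esub>"
      using a b c d by (simp add: mult_self_ideal_mat one_self_idealization)
    then show "self_ideal_mat R a b \<in> Units (self_idealization R)"
      using a b c d S.divides_one
      by (metis self_ideal_mat_in_carrier_iff dividesI)
  qed
qed

lemma same_ideal_associates_self_idealization_iff:
  assumes "x \<in> carrier (self_idealization R)" "y \<in> carrier (self_idealization R)"
  shows "same_ideal_associates (self_idealization R) x y \<longleftrightarrow> x \<sim>\<^bsub>self_idealization R\<^esub> y"
  using cring.associated_iff_same_ideal[OF cring_self_idealization assms]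
  by (simp add: same_ideal_associates_def)

end

section \<open>Irreducibility in terms of the entries\<close>

context domain
begin

lemma zero_not_unit: "\<zero> \<notin> Units R"
  by (auto simp: Units_def)

text \<open>
  If \<open>(c, d) (e, f)\<close> divides \<open>(c, d)\<close> with cofactor \<open>(g, h)\<close>, then the first entries satisfy
  \<open>c = c e g\<close>, and cancelling the nonzero \<open>c\<close> leaves \<open>e g = 1\<close>. In a ring with zero divisors,
  associated elements need not differ by a unit factor; the assumption on \<open>c e\<close> excludes this.
\<close>

lemma self_idealization_factor_associated_iff:
  assumes carr: "c \<in> carrier R" "d \<in> carrier R" "e \<in> carrier R" "f \<in> carrier R"
    and nz: "c \<otimes> e \<noteq> \<zero>"
  shows "self_ideal_mat R c d \<sim>\<^bsub>self_idealization R\<^esub>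
      (self_ideal_mat R c d \<otimes>\<^bsub>self_idealization R\<^esub> self_ideal_mat R e f) \<longleftrightarrow> e \<in> Units R"
proof -
  interpret S: cring "self_idealization R"
    by (rule cring_self_idealization)
  show ?thesis
  proof
    assume "self_ideal_mat R c d \<sim>\<^bsub>self_idealization R\<^esub>
      (self_ideal_mat R c d \<otimes>\<^bsub>self_idealization R\<^esub> self_ideal_mat R e f)"
    then obtain g h where gh: "g \<in> carrier R" "h \<in> carrier R"
      and "self_ideal_mat R c d =
        (self_ideal_mat R c d \<otimes>\<^bsub>self_idealization R\<^esub> self_ideal_mat R e f)
          \<otimes>\<^bsub>self_idealization R\<^esub> self_ideal_mat R g h"
      by (auto simp: associated_def factor_def carrier_self_idealization)
    then have "c = c \<otimes> e \<otimes> g"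
      using carr by (simp add: mult_self_ideal_mat self_ideal_mat_eq_iff)
    then have "c \<otimes> \<one> = c \<otimes> (e \<otimes> g)" and "c \<noteq> \<zero>"
      using carr gh nz by (auto simp: m_assoc)
    then have "\<one> = e \<otimes> g"
      using carr gh m_lcancel[of c \<one> "e \<otimes> g"] by simp
    then show "e \<in> Units R"
      using carr gh mult_eq_one_imp_Units by metis
  next
    assume "e \<in> Units R"
    then have "self_ideal_mat R e f \<in> Units (self_idealization R)"
      using carr by (simp add: self_ideal_mat_Units_iff)
    then show "self_ideal_mat R c d \<sim>\<^bsub>self_idealization R\<^esub>
      (self_ideal_mat R c d \<otimes>\<^bsub>self_idealization R\<^esub> self_ideal_mat R e f)"
      using carr
      by (intro S.associated_sym[OF S.associatedI2]) (auto simp: self_ideal_mat_in_carrier_iff)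
  qed
qed

text \<open>
  This translates irreducibility into a statement about \<open>D\<close> alone: a factor is associated with
  \<open>(a, b)\<close> iff the first entry of the other factor is a unit, and the second entry \<open>c f + d e\<close> of a
  product with first entry \<open>c e\<close> is an arbitrary element of the ideal \<open>(c, e)\<close>.
\<close>

lemma associate_irreducible_nonzero:
  assumes a: "a \<in> carrier R" "a \<noteq> \<zero>" and b: "b \<in> carrier R"
  shows "associate_irreducible (self_idealization R) (self_ideal_mat R a b) \<longleftrightarrow>
    a \<notin> Units R \<and>
    (\<forall>c\<in>carrier R. \<forall>d\<in>carrier R. \<forall>e\<in>carrier R. \<forall>f\<in>carrier R.
      a = c \<otimes> e \<and> b = c \<otimes> f \<oplus> d \<otimes> e \<longrightarrow> c \<in> Units R \<or> e \<in> Units R)"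
proof -
  let ?S = "self_idealization R" and ?M = "self_ideal_mat R"
  interpret S: cring ?S
    by (rule cring_self_idealization)
  have factor: "same_ideal_associates ?S (?M c d) (?M a b) \<or> same_ideal_associates ?S (?M e f) (?M a b)
      \<longleftrightarrow> e \<in> Units R \<or> c \<in> Units R"
    if carr: "c \<in> carrier R" "d \<in> carrier R" "e \<in> carrier R" "f \<in> carrier R"
      and eq: "?M a b = ?M c d \<otimes>\<^bsub>?S\<^esub> ?M e f" for c d e f
  proof -
    have ac: "a = c \<otimes> e"
      using carr eq by (simp add: mult_self_ideal_mat self_ideal_mat_eq_iff)
    have eq': "?M a b = ?M e f \<otimes>\<^bsub>?S\<^esub> ?M c d"
      using carr eq by (simp add: S.m_comm self_ideal_mat_in_carrier_iff)
    have "?M c d \<sim>\<^bsub>?S\<^esub> ?M a b \<longleftrightarrow> e \<in> Units R"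
      using self_idealization_factor_associated_iff[of c d e f] carr ac a eq by simp
    moreover have "?M e f \<sim>\<^bsub>?S\<^esub> ?M a b \<longleftrightarrow> c \<in> Units R"
      using self_idealization_factor_associated_iff[of e f c d] carr ac a eq' m_comm[of c e] by simp
    ultimately show ?thesis
      using carr a b
      by (simp add: same_ideal_associates_self_idealization_iff self_ideal_mat_in_carrier_iff)
  qed
  have entries: "(?M a b = ?M c d \<otimes>\<^bsub>?S\<^esub> ?M e f \<longrightarrow>
        same_ideal_associates ?S (?M c d) (?M a b) \<or> same_ideal_associates ?S (?M e f) (?M a b)) \<longleftrightarrow>
      (a = c \<otimes> e \<and> b = c \<otimes> f \<oplus> d \<otimes> e \<longrightarrow> c \<in> Units R \<or> e \<in> Units R)"
    if carr: "c \<in> carrier R" "d \<in> carrier R" "e \<in> carrier R" "f \<in> carrier R" for c d e f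
  proof -
    have "?M a b = ?M c d \<otimes>\<^bsub>?S\<^esub> ?M e f \<longleftrightarrow> a = c \<otimes> e \<and> b = c \<otimes> f \<oplus> d \<otimes> e"
      using carr by (simp add: mult_self_ideal_mat self_ideal_mat_eq_iff)
    then show ?thesis
      using factor[OF carr] by blast
  qed
  have "associate_irreducible ?S (?M a b) \<longleftrightarrow> a \<notin> Units R \<and>
      (\<forall>c\<in>carrier R. \<forall>d\<in>carrier R. \<forall>e\<in>carrier R. \<forall>f\<in>carrier R. ?M a b = ?M c d \<otimes>\<^bsub>?S\<^esub> ?M e f \<longrightarrow>
        same_ideal_associates ?S (?M c d) (?M a b) \<or> same_ideal_associates ?S (?M e f) (?M a b))"
    using a b unfolding associate_irreducible_def
    by (auto simp: self_ideal_mat_Units_iff carrier_self_idealization)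
  also have "\<dots> \<longleftrightarrow> a \<notin> Units R \<and>
    (\<forall>c\<in>carrier R. \<forall>d\<in>carrier R. \<forall>e\<in>carrier R. \<forall>f\<in>carrier R.
      a = c \<otimes> e \<and> b = c \<otimes> f \<oplus> d \<otimes> e \<longrightarrow> c \<in> Units R \<or> e \<in> Units R)"
    by (intro conj_cong ball_cong refl entries)
  finally show ?thesis .
qed

text \<open>
  In \<open>(0, b) = (b, 0) (0, 1)\<close> the first factor is associated with the product only if \<open>b = 0\<close> and
  the second only if \<open>b\<close> is a unit; for \<open>b = 0\<close> the factorization \<open>(0, 0) = (0, 1) (0, 1)\<close> is used
  instead. Conversely, if \<open>b\<close> is a unit, then one factor of \<open>(0, b)\<close> is of the form \<open>(0, d)\<close> and
  the first entry of the other one divides \<open>b\<close>.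
\<close>

lemma associate_irreducible_zero:
  assumes b: "b \<in> carrier R"
  shows "associate_irreducible (self_idealization R) (self_ideal_mat R \<zero> b) \<longleftrightarrow> b \<in> Units R"
proof -
  let ?S = "self_idealization R" and ?M = "self_ideal_mat R"
  interpret S: cring ?S
    by (rule cring_self_idealization)
  note carrier_iff = self_ideal_mat_in_carrier_iff
  show ?thesis
  proof
    assume irr: "associate_irreducible ?S (?M \<zero> b)"
    have one: "b \<in> Units R" if "same_ideal_associates ?S (?M \<zero> \<one>) (?M \<zero> b)"
    proof -
      have "?M \<zero> b divides\<^bsub>?S\<^esub> ?M \<zero> \<one>"
        using that b
        by (simp add: same_ideal_associates_self_idealization_iff carrier_iff associated_def)
      then obtain g h where "g \<in> carrier R" "h \<in> carrier R" "?M \<zero> \<one> = ?M \<zero> b \<otimes>\<^bsub>?S\<^esub> ?M g h"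
        by (auto simp: factor_def carrier_self_idealization)
      then have "g \<in> carrier R" "\<one> = b \<otimes> g"
        using b by (auto simp: mult_self_ideal_mat self_ideal_mat_eq_iff)
      then show ?thesis
        using b mult_eq_one_imp_Units by metis
    qed
    show "b \<in> Units R"
    proof (cases "b = \<zero>")
      case True
      have "?M \<zero> b = ?M \<zero> \<one> \<otimes>\<^bsub>?S\<^esub> ?M \<zero> \<one>"
        using True by (simp add: mult_self_ideal_mat)
      then have "same_ideal_associates ?S (?M \<zero> \<one>) (?M \<zero> b)"
        using irr unfolding associate_irreducible_def by (metis carrier_iff zero_closed one_closed)
      then show ?thesis
        by (fact one)
    next
      case False
      have "?M \<zero> b = ?M b \<zero> \<otimes>\<^bsub>?S\<^esub> ?M \<zero> \<one>"
        using b by (simp add: mult_self_ideal_mat)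
      then have "same_ideal_associates ?S (?M b \<zero>) (?M \<zero> b) \<or>
          same_ideal_associates ?S (?M \<zero> \<one>) (?M \<zero> b)"
        using irr b unfolding associate_irreducible_def by (auto simp: carrier_iff)
      moreover have "\<not> same_ideal_associates ?S (?M b \<zero>) (?M \<zero> b)"
      proof
        assume "same_ideal_associates ?S (?M b \<zero>) (?M \<zero> b)"
        then have "?M \<zero> b divides\<^bsub>?S\<^esub> ?M b \<zero>"
          using b by (simp add: same_ideal_associates_self_idealization_iff carrier_iff associated_def)
        then obtain g h where "g \<in> carrier R" "h \<in> carrier R" "?M b \<zero> = ?M \<zero> b \<otimes>\<^bsub>?S\<^esub> ?M g h"
          by (auto simp: factor_def carrier_self_idealization)
        then show False
          using b False by (simp add: mult_self_ideal_mat self_ideal_mat_eq_iff)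
      qed
      ultimately show ?thesis
        using one by blast
    qed
  next
    assume u: "b \<in> Units R"
    have associated: "same_ideal_associates ?S (?M \<zero> d) (?M \<zero> b)"
      if "d \<in> carrier R" "e \<in> carrier R" "f \<in> carrier R" "b = d \<otimes> e" for d e f
    proof -
      have "e \<in> Units R"
        using u that unit_factor[of e d] by (simp add: m_comm)
      then have "?M e f \<in> Units ?S"
        using that by (simp add: self_ideal_mat_Units_iff)
      moreover have "?M \<zero> b = ?M \<zero> d \<otimes>\<^bsub>?S\<^esub> ?M e f"
        using that by (simp add: mult_self_ideal_mat)
      ultimately have "?M \<zero> b \<sim>\<^bsub>?S\<^esub> ?M \<zero> d"
        using that by (intro S.associatedI2) (auto simp: carrier_iff)
      then show ?thesis
        using that b S.associated_sym
        by (simp add: same_ideal_associates_self_idealization_iff carrier_iff)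
    qed
    have factors: "same_ideal_associates ?S (?M c d) (?M \<zero> b) \<or> same_ideal_associates ?S (?M e f) (?M \<zero> b)"
      if carr: "c \<in> carrier R" "d \<in> carrier R" "e \<in> carrier R" "f \<in> carrier R"
        and eq: "?M \<zero> b = ?M c d \<otimes>\<^bsub>?S\<^esub> ?M e f" for c d e f
    proof -
      have ce: "c \<otimes> e = \<zero>" and b_eq: "b = c \<otimes> f \<oplus> d \<otimes> e"
        using carr eq by (auto simp: mult_self_ideal_mat self_ideal_mat_eq_iff)
      show ?thesis
      proof (cases "c = \<zero>")
        case True
        then have "b = d \<otimes> e"
          using b_eq carr by simp
        then show ?thesis
          using associated[of d e f] True carr by simp
      next
        case False
        then have "e = \<zero>"
          using ce carr integral by blast
        then have "b = f \<otimes> c"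
          using b_eq carr by (simp add: m_comm)
        then show ?thesis
          using associated[of f c d] \<open>e = \<zero>\<close> carr by simp
      qed
    qed
    show "associate_irreducible ?S (?M \<zero> b)"
      using b factors zero_not_unit unfolding associate_irreducible_def
      by (auto simp: self_ideal_mat_Units_iff carrier_self_idealization)
  qed
qed

end

section \<open>Prime powers in a principal ideal domain\<close>

context domain
begin

lemma prime_not_unit: "ring_prime p \<Longrightarrow> p \<notin> Units R"
  by (simp add: ring_prime_def prime_def)

lemma prime_divides_prod:
  assumes "ring_prime p" "x \<in> carrier R" "y \<in> carrier R" "p divides (x \<otimes> y)"
  shows "p divides x \<or> p divides y"
  using assms by (auto simp: ring_prime_def prime_def)

lemma prime_not_divides_unit:
  assumes "p \<in> carrier R" "ring_prime p" "u \<in> Units R"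
  shows "\<not> p divides u"
  using assms prime_not_unit by (metis Units_closed divides_unit)

lemma prime_unit_mult:
  assumes p: "p \<in> carrier R" "ring_prime p" and u: "u \<in> Units R"
  shows "ring_prime (u \<otimes> p)"
proof -
  have "(u \<otimes> p) \<sim> p"
    using p u ring_associated_iff[of "u \<otimes> p" p] by auto
  then have "p \<sim>\<^bsub>mult_of R\<^esub> (u \<otimes> p)"
    using p u assoc_iff_assoc_mult associated_sym Units_closed m_closed by meson
  moreover have "u \<otimes> p \<noteq> \<zero>" "p \<noteq> \<zero>" "prime (mult_of R) p"
    using p u ring_primeE[OF p] zero_not_unit by (auto simp: integral_iff Units_closed)
  ultimately show ?thesis
    using p u mult_of.prime_cong[of p "u \<otimes> p"] by (intro ring_primeI') auto
qed

text \<open>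
  A prime \<open>r\<close> dividing \<open>u p\<^sup>n\<close> divides \<open>p\<close>; as \<open>p\<close> is prime too, the two are associated.
\<close>

lemma prime_divides_unit_mult_prime_pow:
  assumes r: "r \<in> carrier R" "ring_prime r" and p: "p \<in> carrier R" "ring_prime p"
    and u: "u \<in> Units R" and dvd: "r divides (u \<otimes> p [^] (n::nat))"
  shows "p divides r"
proof -
  have "r divides p" if "r divides (p [^] n)" for n :: nat
    using that
  proof (induction n)
    case 0
    then show ?case
      using prime_not_divides_unit[OF r, of \<one>] by simp
  next
    case (Suc n)
    then show ?case
      using prime_divides_prod[OF r(2), of "p [^] n" p] p by auto
  qed
  moreover have "r divides (p [^] n)"
    using prime_divides_prod[OF r(2) _ _ dvd] prime_not_divides_unit[OF r u] u p by auto
  ultimately have "r divides p"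
    by blast
  then obtain x where x: "x \<in> carrier R" "p = r \<otimes> x"
    by (auto simp: factor_def)
  have "p divides (r \<otimes> x)"
    using x p by simp
  then consider "p divides r" | "p divides x"
    using prime_divides_prod[OF p(2) r(1) x(1)] by blast
  then show ?thesis
  proof cases
    case 2
    then obtain y where y: "y \<in> carrier R" "x = p \<otimes> y"
      by (auto simp: factor_def)
    then have "p \<otimes> \<one> = p \<otimes> (r \<otimes> y)"
      using x p r by (simp add: m_lcomm)
    then have "\<one> = r \<otimes> y"
      using p r y ring_primeE(1)[OF p] m_lcancel[of p \<one> "r \<otimes> y"] by simp
    then have "r \<in> Units R"
      using r y mult_eq_one_imp_Units by metis
    then show ?thesis
      using r prime_not_unit by blast
  qed
qed

end

context principal_domain
begin

lemma exists_prime_divisor: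
  assumes "a \<in> carrier R" "a \<noteq> \<zero>" "a \<notin> Units R"
  obtains p where "p \<in> carrier R" "ring_prime p" "p divides a"
  using assms exists_irreducible_divisor[of a] primeness_condition by (metis Diff_iff singletonD)

text \<open>
  Dividing by \<open>p\<close> as long as possible stops: each step passes to a proper divisor, and proper
  divisibility among the nonzero elements of a principal ideal domain is well-founded.
\<close>

lemma split_off_prime_power:
  assumes p: "p \<in> carrier R" "ring_prime p" and a: "a \<in> carrier R" "a \<noteq> \<zero>"
  obtains n :: nat and q where "q \<in> carrier R" "a = q \<otimes> p [^] n" "\<not> p divides q"
proof -
  have "\<exists>(n::nat) q. q \<in> carrier R \<and> a = q \<otimes> p [^] n \<and> \<not> p divides q"
    using mult_of.division_wellfounded a
  proof (induction a rule: wf_induct_rule)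
    case (less a)
    show ?case
    proof (cases "p divides a")
      case True
      then obtain x where x: "x \<in> carrier R" "a = p \<otimes> x"
        by (auto simp: factor_def)
      then have "x \<noteq> \<zero>"
        using less.prems p by auto
      have "a = x \<otimes> p"
        using x p by (simp add: m_comm)
      then have "properfactor (mult_of R) x a"
        using mult_of.properfactorI3[of a x p] x(1) p \<open>x \<noteq> \<zero>\<close> prime_not_unit[OF p(2)] ring_primeE(1)[OF p]
        by simp
      then obtain n :: nat and q where "q \<in> carrier R" "x = q \<otimes> p [^] n" "\<not> p divides q"
        using less.IH[of x] x \<open>x \<noteq> \<zero>\<close> less.prems by auto
      then have "a = q \<otimes> p [^] Suc n"
        using x p by (simp add: m_ac)
      then show ?thesis
        using \<open>q \<in> carrier R\<close> \<open>\<not> p divides q\<close> by blast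
    next
      case False
      then have "a = a \<otimes> p [^] (0::nat)"
        using less.prems by simp
      then show ?thesis
        using False less.prems by blast
    qed
  qed
  then show ?thesis
    using that by blast
qed

lemma coprime_iff_no_common_prime:
  assumes a: "a \<in> carrier R" "a \<noteq> \<zero>" and b: "b \<in> carrier R"
  shows "\<one> gcdof a b \<longleftrightarrow> \<not> (\<exists>p\<in>carrier R. ring_prime p \<and> p divides a \<and> p divides b)"
proof
  assume "\<one> gcdof a b"
  then show "\<not> (\<exists>p\<in>carrier R. ring_prime p \<and> p divides a \<and> p divides b)"
    using prime_not_divides_unit by (auto simp: isgcd_def)
next
  assume none: "\<not> (\<exists>p\<in>carrier R. ring_prime p \<and> p divides a \<and> p divides b)"
  have "y \<in> Units R" if y: "y \<in> carrier R" "y divides a" "y divides b" for y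
  proof (rule ccontr)
    assume "y \<notin> Units R"
    moreover have "y \<noteq> \<zero>"
      using y a zero_divides by auto
    ultimately obtain p where "p \<in> carrier R" "ring_prime p" "p divides y"
      using exists_prime_divisor y by blast
    then show False
      using none y divides_trans[of p y] by metis
  qed
  then show "\<one> gcdof a b"
    using a b one_divides divides_one by (auto simp: isgcd_def)
qed

lemma coprime_combination:
  assumes carr: "c \<in> carrier R" "e \<in> carrier R" "b \<in> carrier R" and gcd: "\<one> gcdof c e"
  obtains d f where "d \<in> carrier R" "f \<in> carrier R" "b = c \<otimes> f \<oplus> d \<otimes> e"
proof -
  have "PIdl \<one> = PIdl c <+>\<^bsub>R\<^esub> PIdl e"
    using ideal_sum_iff_gcd[of c e \<one>] carr gcd by simp
  then have "b \<in> PIdl c <+>\<^bsub>R\<^esub> PIdl e"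
    using ideal_eq_carrier_iff[of \<one>] carr by auto
  then obtain f d where "f \<in> carrier R" "d \<in> carrier R" "b = f \<otimes> c \<oplus> d \<otimes> e"
    by (auto simp: set_add_def' cgenideal_def)
  then show ?thesis
    using that carr by (simp add: m_comm)
qed

section \<open>The classification\<close>

text \<open>
  A prime \<open>a\<close> has no factorization into nonunits at all, so \<open>b\<close> is arbitrary in that case. For
  \<open>a = u p\<^sup>n\<close> with \<open>n \<ge> 2\<close> both factors of any factorization into nonunits are multiples of \<open>p\<close>,
  and \<open>p (u p\<^bsup>n-1\<^esup>)\<close> is one for which the two factors generate exactly the ideal \<open>(p)\<close>; so
  irreducibility says that \<open>p\<close> does not divide \<open>b\<close>.
\<close>

lemma associate_irreducible_nonzero_iff_prime_power:
  assumes a: "a \<in> carrier R" "a \<noteq> \<zero>" and b: "b \<in> carrier R"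
  shows "associate_irreducible (self_idealization R) (self_ideal_mat R a b) \<longleftrightarrow>
    ring_prime a \<or>
    (\<exists>p\<in>carrier R. \<exists>u\<in>Units R. \<exists>n::nat. ring_prime p \<and> n \<ge> 2 \<and> a = u \<otimes> p [^] n \<and> \<one> gcdof a b)"
    (is "?irr \<longleftrightarrow> _ \<or> ?pow")
proof
  assume ?irr
  then have irr: "c \<in> Units R \<or> e \<in> Units R"
    if "a = c \<otimes> e" "b = c \<otimes> f \<oplus> d \<otimes> e"
      "c \<in> carrier R" "d \<in> carrier R" "e \<in> carrier R" "f \<in> carrier R" for c d e f
    using associate_irreducible_nonzero[OF a b] that by blast
  have "a \<notin> Units R"
    using \<open>?irr\<close> associate_irreducible_nonzero[OF a b] by blast
  then obtain p where p: "p \<in> carrier R" "ring_prime p" "p divides a"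
    using exists_prime_divisor a by blast
  obtain n :: nat and q where q: "q \<in> carrier R" "a = q \<otimes> p [^] n" "\<not> p divides q"
    using split_off_prime_power[OF p(1,2) a] .
  have "n \<noteq> 0"
    using p q by (intro notI) simp
  then obtain m where m: "n = Suc m"
    using not0_implies_Suc by blast
  have pow_not_unit: "p [^] Suc k \<notin> Units R" for k :: nat
  proof -
    have "p divides (p [^] Suc k)"
      using p by (auto intro!: divides_prod_l)
    then show ?thesis
      using prime_not_divides_unit[OF p(1,2)] by blast
  qed
  (* q and p^n generate the unit ideal, so b is no obstruction to the factorization q p^n *)
  have "\<one> gcdof q (p [^] n)"
  proof -
    have "p divides r" if "r \<in> carrier R" "ring_prime r" "r divides (p [^] n)" for r
      using prime_divides_unit_mult_prime_pow[OF that(1,2) p(1,2), of \<one> n] that p by simp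
    moreover have "q \<noteq> \<zero>"
      using divides_zero[OF p(1)] q(3) by auto
    ultimately show ?thesis
      using coprime_iff_no_common_prime[of q "p [^] n"] p q divides_trans by blast
  qed
  then obtain d f where "d \<in> carrier R" "f \<in> carrier R" "b = q \<otimes> f \<oplus> d \<otimes> p [^] n"
    using coprime_combination[of q "p [^] n" b] p q b by blast
  then have u: "q \<in> Units R"
    using irr[of q "p [^] n" f d] q p m pow_not_unit[of m] by auto
  show "ring_prime a \<or> ?pow"
  proof (cases m)
    case 0
    then show ?thesis
      using prime_unit_mult[OF p(1,2) u] q m p by simp
  next
    case (Suc k)
    have "\<not> p divides b"
    proof
      assume "p divides b"
      then obtain f where f: "f \<in> carrier R" "b = p \<otimes> f"
        by (auto simp: factor_def)
      have "a = p \<otimes> (q \<otimes> p [^] m)"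
        using q p m by (simp add: m_ac)
      moreover have "b = p \<otimes> f \<oplus> \<zero> \<otimes> (q \<otimes> p [^] m)"
        using f q p by simp
      ultimately have "q \<otimes> p [^] m \<in> Units R"
        using irr[of p "q \<otimes> p [^] m" f \<zero>] prime_not_unit f q p by auto
      moreover have "p divides (q \<otimes> p [^] m)"
        using p q Suc by (auto intro!: divides_prod_l)
      ultimately show False
        using prime_not_divides_unit[OF p(1,2)] by blast
    qed
    moreover have "p divides r" if "r \<in> carrier R" "ring_prime r" "r divides a" for r
      using prime_divides_unit_mult_prime_pow[OF that(1,2) p(1,2) u, of n] that q by simp
    ultimately have "\<one> gcdof a b"
      using coprime_iff_no_common_prime[OF a b] p divides_trans by blast
    then show ?thesis
      using p u q m Suc by (intro disjI2 bexI[of _ p] bexI[of _ q] exI[of _ n]) auto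
  qed
next
  assume "ring_prime a \<or> ?pow"
  then show ?irr
  proof
    assume prime: "ring_prime a"
    then have "ring_irreducible a"
      using primeness_condition a by blast
    then show ?irr
      using associate_irreducible_nonzero[OF a b] ring_irreducibleE(4,5)[of a] a by blast
  next
    assume ?pow
    then obtain p u and n :: nat where p: "p \<in> carrier R" "ring_prime p" and u: "u \<in> Units R"
      and n: "n \<ge> 2" "a = u \<otimes> p [^] n" and gcd: "\<one> gcdof a b"
      by blast
    obtain m where m: "n = Suc m"
      using n by (cases n) auto
    have p_a: "p divides a"
      using n p u m by (auto intro!: divides_prod_l)
    have p_dvd: "p divides c" if c: "c \<in> carrier R" "c divides a" "c \<notin> Units R" for c
    proof -
      have "c \<noteq> \<zero>"
        using a c zero_divides by auto
      then obtain r where r: "r \<in> carrier R" "ring_prime r" "r divides c"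
        using exists_prime_divisor c by blast
      then have "r divides (u \<otimes> p [^] n)"
        using c n divides_trans by blast
      then have "p divides r"
        using prime_divides_unit_mult_prime_pow[OF r(1,2) p u] by blast
      then show ?thesis
        using r p divides_trans by blast
    qed
    have "c \<in> Units R \<or> e \<in> Units R"
      if carr: "c \<in> carrier R" "d \<in> carrier R" "e \<in> carrier R" "f \<in> carrier R"
        and eq: "a = c \<otimes> e" "b = c \<otimes> f \<oplus> d \<otimes> e" for c d e f
    proof (rule ccontr)
      assume nonunits: "\<not> ?thesis"
      have "c divides a" "e divides a"
        using carr eq(1) m_comm by (auto simp: factor_def)
      then have "p divides c" "p divides e"
        using p_dvd nonunits carr by auto
      then obtain x y where "x \<in> carrier R" "c = p \<otimes> x" "y \<in> carrier R" "e = p \<otimes> y"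
        by (auto simp: factor_def)
      then have "b = p \<otimes> (x \<otimes> f \<oplus> d \<otimes> y)"
        using eq(2) carr p by (simp add: r_distr m_ac)
      then have "p divides b"
        using \<open>x \<in> _\<close> \<open>y \<in> _\<close> carr by (auto simp: factor_def)
      then show False
        using coprime_iff_no_common_prime[OF a b] gcd p p_a by blast
    qed
    moreover have "a \<notin> Units R"
      using prime_not_divides_unit[OF p] p_a by blast
    ultimately show ?irr
      using associate_irreducible_nonzero[OF a b] by blast
  qed
qed

end

theorem theorem5:
  fixes D :: "('a, 'm) ring_scheme" and a b :: 'a
  assumes "principal_domain D"
    and "a \<in> carrier D" and "b \<in> carrier D"
  shows "associate_irreducible (self_idealization D) (self_ideal_mat D a b) \<longleftrightarrow>
      (a = \<zero>\<^bsub>D\<^esub> \<and> b \<in> Units D) \<or>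
      (\<exists>p \<in> carrier D. ring_prime\<^bsub>D\<^esub> p \<and> a = p) \<or>
      (\<exists>p \<in> carrier D. \<exists>u \<in> Units D. \<exists>n::nat. ring_prime\<^bsub>D\<^esub> p \<and> n \<ge> 2 \<and>
        a = u \<otimes>\<^bsub>D\<^esub> p [^]\<^bsub>D\<^esub> n \<and> \<one>\<^bsub>D\<^esub> gcdof\<^bsub>D\<^esub> a b)"
proof -
  interpret principal_domain D
    by fact
  show ?thesis
  proof (cases "a = \<zero>\<^bsub>D\<^esub>")
    case True
    have "u \<otimes>\<^bsub>D\<^esub> p [^]\<^bsub>D\<^esub> n \<noteq> \<zero>\<^bsub>D\<^esub>"
      if "p \<in> carrier D" "ring_prime\<^bsub>D\<^esub> p" "u \<in> Units D" for p u and n :: nat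
    proof -
      have "p [^]\<^bsub>D\<^esub> n \<noteq> \<zero>\<^bsub>D\<^esub>"
        using that ring_primeE(1) by (induction n) (auto simp: integral_iff)
      moreover have "u \<noteq> \<zero>\<^bsub>D\<^esub>"
        using that zero_not_unit by blast
      ultimately show ?thesis
        using that by (simp add: integral_iff Units_closed)
    qed
    then show ?thesis
      using associate_irreducible_zero[OF assms(3)] True ring_primeE(1) by metis
  next
    case False
    then show ?thesis
      using associate_irreducible_nonzero_iff_prime_power[OF assms(2) False assms(3)] assms(2)
      by blast
  qed
qed

end
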